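(* If a real $d\times n$ matrix $M$ has Kapranov rank equal to $d$, then it has tropical rank equal to $d$ as well.
   Context: Tropical rank: a square matrix $(m_{ij})\in\mathbb{R}^{r\times r}$ is tropically singular if $\min_{\sigma\in\mathcal{S}_r}(m_{1\sigma_1}+\cdots+m_{r\sigma_r})$ is attained by at least two permutations $\sigma$; otherwise it is tropically non-singular. The tropical rank of $M$ is the largest $r$ such that $M$ has a tropically non-singular $r\times r$ submatrix. Kapranov rank: let $\tilde K$ be the field of formal power series $f=\sum_a c_a t^a$ with complex coefficients and real exponents, with well-ordered support; for $f\ne 0$ let $\deg(f)$ be the smallest exponent $a$ with $c_a\neq 0$. A tropical linear space in $\mathbb{R}^d$ is a set of the form $\{(\deg f_1,\dots,\deg f_d) : (f_1,\dots,f_d)\in V,\ \text{all } f_i\ne 0\}$, where $V$ is a linear subspace of $\tilde K^d$ (equivalently, the common zero set of linear forms $a_1x_1+\cdots+a_dx_d$ with coefficients in $\tilde K$); its dimension is $\dim_{\tilde K}V$. The Kapranov rank of $M\in\mathbb{R}^{d\times n}$ is the smallest dimension of a tropical linear space in $\mathbb{R}^d$ containing all columns of $M$. *)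

theory Defs
  imports "HOL-Analysis.Analysis"
begin

section \<open>Well-ordered sets of reals\<close>

text \<open>As the reals are linearly ordered, a set \<open>A\<close> of reals is well-ordered iff \<open><\<close> is
  well-founded on \<open>A\<close>.\<close>

abbreviation wo :: "real set \<Rightarrow> bool"
  where "wo A \<equiv> wfp_on A (<)"

lemma wo_iff: "wo A \<longleftrightarrow> (\<forall>B\<subseteq>A. B \<noteq> {} \<longrightarrow> (\<exists>m\<in>B. \<forall>b\<in>B. m \<le> b))"
  unfolding wfp_on_iff_ex_minimal by (metis not_le)

lemma wo_min:
  assumes "wo A" "B \<subseteq> A" "B \<noteq> {}"
  obtains m where "m \<in> B" "\<And>b. b \<in> B \<Longrightarrow> m \<le> b"
proof -
  have "\<exists>m\<in>B. \<forall>b\<in>B. m \<le> b"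
    using assms(1)[unfolded wo_iff, rule_format, OF assms(2,3)] .
  then show ?thesis using that by blast
qed

lemma wo_subset: "wo B \<Longrightarrow> A \<subseteq> B \<Longrightarrow> wo A"
  by (rule wfp_on_subset)

lemma wo_finite:
  assumes "finite A"
  shows "wo A"
  unfolding wo_iff
proof (intro allI impI)
  fix B assume "B \<subseteq> A" "B \<noteq> {}"
  then have "finite B" using assms finite_subset by blast
  then have "Min B \<in> B" "\<forall>b\<in>B. Min B \<le> b" using \<open>B \<noteq> {}\<close> by auto
  then show "\<exists>m\<in>B. \<forall>b\<in>B. m \<le> b" by blast
qed

lemma wo_Un:
  assumes "wo A" "wo B"
  shows "wo (A \<union> B)"
  unfolding wo_iff
proof (intro allI impI)
  fix C assume C: "C \<subseteq> A \<union> B" "C \<noteq> {}"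
  consider "C \<inter> A = {}" | "C \<inter> B = {}" | "C \<inter> A \<noteq> {}" "C \<inter> B \<noteq> {}" by blast
  then show "\<exists>m\<in>C. \<forall>b\<in>C. m \<le> b"
  proof cases
    case 1
    then have "C \<subseteq> B" using C by blast
    then show ?thesis using wo_min[OF assms(2)] C(2) by metis
  next
    case 2
    then have "C \<subseteq> A" using C by blast
    then show ?thesis using wo_min[OF assms(1)] C(2) by metis
  next
    case 3
    obtain m where m: "m \<in> C \<inter> A" "\<And>b. b \<in> C \<inter> A \<Longrightarrow> m \<le> b"
      using wo_min[OF assms(1), of "C \<inter> A"] 3 by (metis Int_lower2)
    obtain k where k: "k \<in> C \<inter> B" "\<And>b. b \<in> C \<inter> B \<Longrightarrow> k \<le> b"
      using wo_min[OF assms(2), of "C \<inter> B"] 3 by (metis Int_lower2)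
    have "min m k \<in> C" using m k by (auto simp: min_def)
    moreover have "\<forall>b\<in>C. min m k \<le> b"
      using m k C by (metis IntI Un_iff min.coboundedI1 min.coboundedI2 subsetD)
    ultimately show ?thesis by blast
  qed
qed

lemma wo_no_decreasing:
  assumes "wo A" "\<And>n. s n \<in> A"
  shows "\<not> (\<forall>n. s (Suc n) < s n)"
proof
  assume dec: "\<forall>n. s (Suc n) < s n"
  have "range s \<subseteq> A" using assms(2) by blast
  then obtain m where "m \<in> range s" "\<And>b. b \<in> range s \<Longrightarrow> m \<le> b"
    using wo_min[OF assms(1), of "range s"] by blast
  then show False using dec by (metis not_le rangeE rangeI)
qed

lemma wo_sums:
  assumes A: "wo A" and B: "wo B"
  shows "wo {x + y |x y. x \<in> A \<and> y \<in> B}"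
  unfolding wo_iff
proof (intro allI impI, rule ccontr)
  fix C assume C: "C \<subseteq> {x + y |x y. x \<in> A \<and> y \<in> B}" "C \<noteq> {}"
    and no: "\<not> (\<exists>m\<in>C. \<forall>b\<in>C. m \<le> b)"
  have nxt: "\<forall>c\<in>C. \<exists>c'\<in>C. c' < c" using no by (metis not_le)
  obtain c0 where "c0 \<in> C" using C by blast
  then obtain s where s: "\<And>n. s n \<in> C" "\<And>n. s (Suc n) < s n"
    using dependent_nat_choice[of "\<lambda>_ c. c \<in> C" "\<lambda>_ c c'. c' < c"] nxt by metis
  have "\<forall>n. \<exists>x y. x \<in> A \<and> y \<in> B \<and> s n = x + y" using C s(1) by blast
  then obtain a b where ab: "\<And>n. a n \<in> A" "\<And>n. b n \<in> B" "\<And>n. s n = a n + b n"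
    by metis
  obtain r where r: "strict_mono r" "monoseq (\<lambda>n. a (r n))"
    using seq_monosub[of a] by blast
  have sdec: "s j < s i" if "i < j" for i j
    using that s(2) by (rule lift_Suc_mono_less[of "\<lambda>n. - s n", simplified, rotated])
  have sr: "s (r (Suc n)) < s (r n)" for n
    using r(1) by (intro sdec) (simp add: strict_mono_def)
  have "\<exists>N. \<forall>n. a (r (N + n)) \<le> a (r (Suc (N + n)))"
  proof -
    consider "\<forall>m. \<forall>n\<ge>m. a (r m) \<le> a (r n)" | "\<forall>m. \<forall>n\<ge>m. a (r n) \<le> a (r m)"
      using r(2) unfolding monoseq_def by blast
    then show ?thesis
    proof cases
      case 1
      then show ?thesis by (metis le_Suc_eq order_refl)
    next
      case 2
      have "range (\<lambda>n. a (r n)) \<subseteq> A" using ab(1) by blast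
      then obtain m where m: "m \<in> range (\<lambda>n. a (r n))" "\<And>x. x \<in> range (\<lambda>n. a (r n)) \<Longrightarrow> m \<le> x"
        using wo_min[OF A] by (metis UNIV_not_empty image_is_empty)
      then obtain N where N: "m = a (r N)" by blast
      have "a (r (N + n)) \<le> a (r N)" "a (r N) \<le> a (r (Suc (N + n)))" for n
        using 2 m N by auto
      then show ?thesis by (meson order_trans)
    qed
  qed
  then obtain N where N: "\<And>n. a (r (N + n)) \<le> a (r (Suc (N + n)))" by blast
  have "b (r (N + Suc n)) < b (r (N + n))" for n
    using N[of n] sr[of "N + n"] ab(3)[of "r (N + n)"] ab(3)[of "r (Suc (N + n))"] by simp
  then show False using wo_no_decreasing[OF B, of "\<lambda>n. b (r (N + n))"] ab(2) by blast
qed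

lemma wo_finite_pairs:
  assumes A: "wo A" and B: "wo B"
  shows "finite {(x, y). x \<in> A \<and> y \<in> B \<and> x + y = (c::real)}" (is "finite ?P")
proof (rule ccontr)
  assume "infinite ?P"
  then obtain p :: "nat \<Rightarrow> real \<times> real" where p: "inj p" "range p \<subseteq> ?P"
    using infinite_countable_subset by blast
  define a where "a = (\<lambda>n. fst (p n))"
  have pa: "p n = (a n, c - a n)" "a n \<in> A" "c - a n \<in> B" for n
    using p(2) unfolding a_def by (auto simp: image_subset_iff split: prod.splits) (smt (verit) prod.collapse)+
  have inj: "a i = a j \<Longrightarrow> i = j" for i j
    using p(1) pa(1) by (metis injD)
  obtain r where r: "strict_mono r" "monoseq (\<lambda>n. a (r n))"
    using seq_monosub[of a] by blast
  have ne: "a (r n) \<noteq> a (r (Suc n))" for n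
    using inj r(1) by (metis n_not_Suc_n strict_mono_eq)
  consider "\<forall>m. \<forall>n\<ge>m. a (r m) \<le> a (r n)" | "\<forall>m. \<forall>n\<ge>m. a (r n) \<le> a (r m)"
    using r(2) unfolding monoseq_def by blast
  then show False
  proof cases
    case 1
    have "c - a (r (Suc n)) < c - a (r n)" for n
      using 1[rule_format, of n "Suc n"] ne[of n] by simp
    then show False using wo_no_decreasing[OF B, of "\<lambda>n. c - a (r n)"] pa(3) by blast
  next
    case 2
    have "a (r (Suc n)) < a (r n)" for n
      using 2[rule_format, of n "Suc n"] ne[of n] by simp
    then show False using wo_no_decreasing[OF A, of "\<lambda>n. a (r n)"] pa(2) by blast
  qed
qed

section \<open>The field of generalized power series\<close>

text \<open>The series \<open>\<Sum>\<^sub>a c\<^sub>a t\<^sup>a\<close> is represented by its coefficient function \<open>a \<mapsto> c\<^sub>a\<close>.\<close>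

typedef hahn = "{f :: real \<Rightarrow> complex. wo {a. f a \<noteq> 0}}"
  morphisms hcoeff Abs_hahn
  by (rule exI[of _ "\<lambda>_. 0"]) (simp add: wo_finite)

definition hsupp :: "hahn \<Rightarrow> real set"
  where "hsupp f = {a. hcoeff f a \<noteq> 0}"

lemma wo_hsupp: "wo (hsupp f)"
  using hcoeff[of f] by (simp add: hsupp_def)

lemma hahn_eqI: "(\<And>a. hcoeff f a = hcoeff g a) \<Longrightarrow> f = g"
  by (simp add: hcoeff_inject[symmetric] fun_eq_iff)

lemma hcoeff_Abs: "wo {a. f a \<noteq> 0} \<Longrightarrow> hcoeff (Abs_hahn f) = f"
  by (simp add: Abs_hahn_inverse)

text \<open>The sum defining the product is finite by \<open>wo_finite_pairs\<close>.\<close>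

instantiation hahn :: "{zero, one, plus, minus, uminus, times}"
begin

definition zero_hahn :: hahn
  where "0 = Abs_hahn (\<lambda>_. 0)"

definition one_hahn :: hahn
  where "1 = Abs_hahn (\<lambda>a. if a = 0 then 1 else 0)"

definition plus_hahn :: "hahn \<Rightarrow> hahn \<Rightarrow> hahn"
  where "f + g = Abs_hahn (\<lambda>a. hcoeff f a + hcoeff g a)"

definition minus_hahn :: "hahn \<Rightarrow> hahn \<Rightarrow> hahn"
  where "f - g = Abs_hahn (\<lambda>a. hcoeff f a - hcoeff g a)"

definition uminus_hahn :: "hahn \<Rightarrow> hahn"
  where "- f = Abs_hahn (\<lambda>a. - hcoeff f a)"

definition times_hahn :: "hahn \<Rightarrow> hahn \<Rightarrow> hahn"
  where "f * g = Abs_hahn (\<lambda>c.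
    \<Sum>(a, b)\<in>{(a, b). a \<in> hsupp f \<and> b \<in> hsupp g \<and> a + b = c}. hcoeff f a * hcoeff g b)"

instance ..

end

lemma hcoeff_0 [simp]: "hcoeff 0 a = 0"
  unfolding zero_hahn_def by (subst hcoeff_Abs) (simp_all add: wo_finite)

lemma hcoeff_1: "hcoeff 1 a = (if a = 0 then 1 else 0)"
  unfolding one_hahn_def by (subst hcoeff_Abs) (simp_all add: wo_finite)

lemma hcoeff_add [simp]: "hcoeff (f + g) a = hcoeff f a + hcoeff g a"
  unfolding plus_hahn_def
  by (subst hcoeff_Abs) (rule wo_subset[OF wo_Un[OF wo_hsupp[of f] wo_hsupp[of g]]], auto simp: hsupp_def)

lemma hcoeff_diff [simp]: "hcoeff (f - g) a = hcoeff f a - hcoeff g a"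
  unfolding minus_hahn_def
  by (subst hcoeff_Abs) (rule wo_subset[OF wo_Un[OF wo_hsupp[of f] wo_hsupp[of g]]], auto simp: hsupp_def)

lemma hcoeff_uminus [simp]: "hcoeff (- f) a = - hcoeff f a"
  unfolding uminus_hahn_def
  by (subst hcoeff_Abs) (rule wo_subset[OF wo_hsupp[of f]], auto simp: hsupp_def)

lemma hcoeff_times:
  "hcoeff (f * g) c =
    (\<Sum>(a, b)\<in>{(a, b). a \<in> hsupp f \<and> b \<in> hsupp g \<and> a + b = c}. hcoeff f a * hcoeff g b)"
  unfolding times_hahn_def
proof (subst hcoeff_Abs)
  let ?P = "\<lambda>c. {(a, b). a \<in> hsupp f \<and> b \<in> hsupp g \<and> a + b = c}"
  let ?F = "\<lambda>c. \<Sum>(a, b)\<in>?P c. hcoeff f a * hcoeff g b"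
  have "{c. ?F c \<noteq> 0} \<subseteq> {a + b |a b. a \<in> hsupp f \<and> b \<in> hsupp g}"
  proof
    fix c assume "c \<in> {c. ?F c \<noteq> 0}"
    then have nz: "?F c \<noteq> 0" by blast
    have "?P c \<noteq> {}"
    proof
      assume e: "?P c = {}"
      have "?F c = 0" unfolding e by (rule sum.empty)
      then show False using nz by blast
    qed
    then show "c \<in> {a + b |a b. a \<in> hsupp f \<and> b \<in> hsupp g}" by auto
  qed
  then show "wo {c. ?F c \<noteq> 0}"
    by (rule wo_subset[OF wo_sums[OF wo_hsupp wo_hsupp]])
qed simp

lemma hcoeff_times_superset:
  assumes "wo A" "wo B" "hsupp f \<subseteq> A" "hsupp g \<subseteq> B"
  shows "hcoeff (f * g) c =
    (\<Sum>(a, b)\<in>{(a, b). a \<in> A \<and> b \<in> B \<and> a + b = c}. hcoeff f a * hcoeff g b)"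
  unfolding hcoeff_times using assms
  by (intro sum.mono_neutral_left wo_finite_pairs) (auto simp: hsupp_def)

lemma hcoeff_times_nz:
  assumes "hcoeff (f * g) c \<noteq> 0"
  obtains a b where "hcoeff f a \<noteq> 0" "hcoeff g b \<noteq> 0" "a + b = c"
proof -
  have "{(a, b). a \<in> hsupp f \<and> b \<in> hsupp g \<and> a + b = c} \<noteq> {}"
    using assms unfolding hcoeff_times by (metis (no_types, lifting) sum.empty)
  then show ?thesis using that by (auto simp: hsupp_def)
qed

lemma hsupp_add: "hsupp (f + g) \<subseteq> hsupp f \<union> hsupp g"
  by (auto simp: hsupp_def)

lemma hsupp_times: "hsupp (f * g) \<subseteq> {a + b |a b. a \<in> hsupp f \<and> b \<in> hsupp g}"
proof
  fix c assume "c \<in> hsupp (f * g)"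
  then show "c \<in> {a + b |a b. a \<in> hsupp f \<and> b \<in> hsupp g}"
    unfolding hsupp_def using hcoeff_times_nz[of f g c] by blast
qed

lemma hahn_mult_commute: "f * g = g * (f :: hahn)"
proof (rule hahn_eqI)
  fix c
  show "hcoeff (f * g) c = hcoeff (g * f) c"
    unfolding hcoeff_times
    by (rule sum.reindex_bij_witness[of _ prod.swap prod.swap]) auto
qed

lemma hahn_mult_assoc: "(f * g) * h = f * (g * h :: hahn)"
proof (rule hahn_eqI)
  fix c
  let ?A = "hsupp f" and ?B = "hsupp g" and ?C = "hsupp h"
  let ?AB = "{a + b |a b. a \<in> ?A \<and> b \<in> ?B}" and ?BC = "{a + b |a b. a \<in> ?B \<and> b \<in> ?C}"
  have w: "wo ?A" "wo ?B" "wo ?C" "wo ?AB" "wo ?BC"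
    by (auto intro: wo_hsupp wo_sums)
  let ?S1 = "SIGMA q:{(s, z). s \<in> ?AB \<and> z \<in> ?C \<and> s + z = c}. {(x, y). x \<in> ?A \<and> y \<in> ?B \<and> x + y = fst q}"
  let ?S2 = "SIGMA q:{(x, s). x \<in> ?A \<and> s \<in> ?BC \<and> x + s = c}. {(y, z). y \<in> ?B \<and> z \<in> ?C \<and> y + z = snd q}"
  have "hcoeff ((f * g) * h) c =
    (\<Sum>q\<in>{(s, z). s \<in> ?AB \<and> z \<in> ?C \<and> s + z = c}.
      \<Sum>p\<in>{(x, y). x \<in> ?A \<and> y \<in> ?B \<and> x + y = fst q}.
        hcoeff f (fst p) * hcoeff g (snd p) * hcoeff h (snd q))"
    by (subst hcoeff_times_superset[OF w(4,3) hsupp_times order_refl])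
      (auto intro!: sum.cong simp: hcoeff_times sum_distrib_right case_prod_beta)
  also have "\<dots> = (\<Sum>(q, p)\<in>?S1. hcoeff f (fst p) * hcoeff g (snd p) * hcoeff h (snd q))"
    by (rule sum.Sigma; intro ballI wo_finite_pairs w)
  also have "\<dots> = (\<Sum>(q, p)\<in>?S2. hcoeff f (fst q) * (hcoeff g (fst p) * hcoeff h (snd p)))"
    by (rule sum.reindex_bij_witness[of _
          "\<lambda>((x, s), (y, z)). ((x + y, z), (x, y))" "\<lambda>((s, z), (x, y)). ((x, y + z), (y, z))"])
      (auto simp: mult.assoc add.assoc)
  also have "\<dots> = (\<Sum>q\<in>{(x, s). x \<in> ?A \<and> s \<in> ?BC \<and> x + s = c}.
      \<Sum>p\<in>{(y, z). y \<in> ?B \<and> z \<in> ?C \<and> y + z = snd q}.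
        hcoeff f (fst q) * (hcoeff g (fst p) * hcoeff h (snd p)))"
    by (rule sum.Sigma[symmetric]; intro ballI wo_finite_pairs w)
  also have "\<dots> = hcoeff (f * (g * h)) c"
    by (subst hcoeff_times_superset[OF w(1,5) order_refl hsupp_times])
      (auto intro!: sum.cong simp: hcoeff_times sum_distrib_left case_prod_beta)
  finally show "hcoeff ((f * g) * h) c = hcoeff (f * (g * h)) c" .
qed

lemma hahn_distrib: "(f + g) * h = f * h + g * (h :: hahn)"
proof (rule hahn_eqI)
  fix c
  let ?A = "hsupp f \<union> hsupp g"
  have w: "wo ?A" by (intro wo_Un wo_hsupp)
  show "hcoeff ((f + g) * h) c = hcoeff (f * h + g * h) c"
    unfolding hcoeff_add
    by (simp add: hcoeff_times_superset[OF w wo_hsupp[of h] hsupp_add order_refl]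
        hcoeff_times_superset[OF w wo_hsupp[of h] Un_upper1 order_refl]
        hcoeff_times_superset[OF w wo_hsupp[of h] Un_upper2 order_refl]
        sum.distrib[symmetric] case_prod_beta algebra_simps)
qed

text \<open>The monomial \<open>c t\<^sup>a\<close>.\<close>

definition hmonom :: "complex \<Rightarrow> real \<Rightarrow> hahn"
  where "hmonom c a = Abs_hahn (\<lambda>b. if b = a then c else 0)"

lemma hcoeff_hmonom: "hcoeff (hmonom c a) b = (if b = a then c else 0)"
  unfolding hmonom_def
  by (subst hcoeff_Abs) (rule wo_finite[OF finite_subset[of _ "{a}"]], auto)

lemma hcoeff_hmonom_times: "hcoeff (hmonom c a * f) b = c * hcoeff f (b - a)"
proof -
  have w: "hsupp (hmonom c a) \<subseteq> {a}" by (auto simp: hsupp_def hcoeff_hmonom split: if_splits)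
  have "hcoeff (hmonom c a * f) b =
      (\<Sum>(x, y)\<in>{(x, y). x \<in> {a} \<and> y \<in> hsupp f \<and> x + y = b}. hcoeff (hmonom c a) x * hcoeff f y)"
    by (intro hcoeff_times_superset w order_refl wo_hsupp wo_finite) simp
  also have "\<dots> = (\<Sum>(x, y)\<in>{(a, b - a)}. hcoeff (hmonom c a) x * hcoeff f y)"
    by (rule sum.mono_neutral_left) (auto simp: hsupp_def)
  finally show ?thesis by (simp add: hcoeff_hmonom)
qed

lemma one_eq_hmonom: "1 = hmonom 1 0"
  by (simp add: one_hahn_def hmonom_def)

instance hahn :: comm_ring_1
proof
  fix f g h :: hahn
  show "f * g * h = f * (g * h)" by (rule hahn_mult_assoc)
  show "f * g = g * f" by (rule hahn_mult_commute)
  show "1 * f = f" by (rule hahn_eqI) (simp add: one_eq_hmonom hcoeff_hmonom_times)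
  show "(f + g) * h = f * h + g * h" by (rule hahn_distrib)
  have "hcoeff 0 0 \<noteq> hcoeff 1 0" by (simp add: hcoeff_1)
  then show "(0 :: hahn) \<noteq> 1" by metis
qed (auto intro!: hahn_eqI)

lemma hcoeff_sum: "hcoeff (sum f A) a = (\<Sum>i\<in>A. hcoeff (f i) a)"
  by (induction A rule: infinite_finite_induct) auto

lemma hahn_geometric_inverse:
  assumes pos: "\<And>a. hcoeff g a \<noteq> 0 \<Longrightarrow> a > 0"
  shows "\<exists>h. (1 - g) * h = 1"
proof (cases "g = 0")
  case True
  then show ?thesis by (intro exI[of _ 1]) simp
next
  case False
  then have "hsupp g \<noteq> {}" unfolding hsupp_def using hahn_eqI[of g 0] by auto
  then obtain m where m: "m \<in> hsupp g" "\<And>b. b \<in> hsupp g \<Longrightarrow> m \<le> b"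
    using wo_min[OF wo_hsupp order_refl] by metis
  have m0: "m > 0" using m(1) pos by (simp add: hsupp_def)
  have pow: "real n * m \<le> a" if "hcoeff (g ^ n) a \<noteq> 0" for n a
    using that
  proof (induction n arbitrary: a)
    case 0
    then show ?case by (simp add: hcoeff_1 split: if_splits)
  next
    case (Suc n)
    then obtain x y where "hcoeff g x \<noteq> 0" "hcoeff (g ^ n) y \<noteq> 0" "x + y = a"
      using hcoeff_times_nz[of g "g ^ n" a] by auto
    then show ?case using Suc.IH[of y] m(2)[of x] by (simp add: hsupp_def algebra_simps)
  qed
  define N where "N a = nat \<lceil>a / m\<rceil>" for a
  have N: "a \<le> real (N a) * m" for a
  proof -
    have "a / m \<le> real (N a)" unfolding N_def by linarith
    then show ?thesis using m0 by (simp add: field_simps)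
  qed
  have vanish: "hcoeff (g ^ n) a = 0" if "n > N b" "a \<le> b" for n a b
  proof (rule ccontr)
    assume "hcoeff (g ^ n) a \<noteq> 0"
    then have "real n * m \<le> real (N b) * m" using pow[of n a] N[of b] that(2) by linarith
    then show False using m0 that(1) by simp
  qed
  define P where "P k = (\<Sum>n\<le>k. g ^ n)" for k
  define F where "F a = hcoeff (P (N a)) a" for a
  have stable: "F a = hcoeff (P (N b)) a" if "a \<le> b" for a b
  proof -
    have "N a \<le> N b" unfolding N_def using that m0
      by (intro nat_mono ceiling_mono divide_right_mono) auto
    then show ?thesis unfolding F_def P_def hcoeff_sum
      by (intro sum.mono_neutral_left ballI vanish[of a]) auto
  qed
  have woF: "wo {a. F a \<noteq> 0}"
    unfolding wo_iff
  proof (intro allI impI)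
    fix C assume C: "C \<subseteq> {a. F a \<noteq> 0}" "C \<noteq> {}"
    then obtain b where b: "b \<in> C" by blast
    have "C \<inter> {..b} \<subseteq> hsupp (P (N b))" using C stable[of _ b] by (auto simp: hsupp_def)
    then obtain k where "k \<in> C \<inter> {..b}" "\<And>x. x \<in> C \<inter> {..b} \<Longrightarrow> k \<le> x"
      using wo_min[OF wo_hsupp, of "C \<inter> {..b}"] b by blast
    then show "\<exists>k\<in>C. \<forall>x\<in>C. k \<le> x" by (metis IntD1 IntD2 IntI atMost_iff linear order_trans)
  qed
  define h where "h = Abs_hahn F"
  have h: "hcoeff h = F" unfolding h_def by (rule hcoeff_Abs[OF woF])
  have "(1 - g) * h = 1"
  proof (rule hahn_eqI)
    fix a
    have "hcoeff ((1 - g) * (h - P (N a))) a = 0"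
    proof (rule ccontr)
      assume "hcoeff ((1 - g) * (h - P (N a))) a \<noteq> 0"
      then obtain x y where xy: "hcoeff (1 - g) x \<noteq> 0" "hcoeff (h - P (N a)) y \<noteq> 0" "x + y = a"
        by (rule hcoeff_times_nz)
      have "x \<ge> 0" using xy(1) pos[of x] by (cases "hcoeff g x = 0") (auto simp: hcoeff_1 split: if_splits)
      then have "y \<le> a" using xy(3) by simp
      then show False using xy(2) stable[of y a] h by simp
    qed
    moreover have "(1 - g) * h = (1 - g) * (h - P (N a)) + (1 - g) * P (N a)"
      by (simp add: algebra_simps)
    moreover have "(1 - g) * P (N a) = 1 - g ^ Suc (N a)"
      unfolding P_def by (rule sum_gp_basic)
    moreover have "hcoeff (g ^ Suc (N a)) a = 0" by (rule vanish[of a]) auto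
    ultimately show "hcoeff ((1 - g) * h) a = hcoeff 1 a" by simp
  qed
  then show ?thesis by blast
qed

text \<open>The smallest exponent in the support; unspecified for the zero series.\<close>

definition hdeg :: "hahn \<Rightarrow> real"
  where "hdeg f = (LEAST a. hcoeff f a \<noteq> 0)"

lemma hdeg:
  assumes "f \<noteq> 0"
  shows "hcoeff f (hdeg f) \<noteq> 0" and "\<And>a. hcoeff f a \<noteq> 0 \<Longrightarrow> hdeg f \<le> a"
proof -
  have "hsupp f \<noteq> {}" using assms hahn_eqI[of f 0] by (auto simp: hsupp_def)
  then obtain m where m: "hcoeff f m \<noteq> 0" "\<And>a. hcoeff f a \<noteq> 0 \<Longrightarrow> m \<le> a"
    using wo_min[OF wo_hsupp[of f] order_refl] unfolding hsupp_def by (metis mem_Collect_eq)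
  have "hdeg f = m" unfolding hdeg_def by (rule Least_equality) (use m in auto)
  then show "hcoeff f (hdeg f) \<noteq> 0" "\<And>a. hcoeff f a \<noteq> 0 \<Longrightarrow> hdeg f \<le> a" using m by auto
qed

lemma hahn_inverse_exists:
  assumes "f \<noteq> (0 :: hahn)"
  shows "\<exists>g. f * g = 1"
proof -
  let ?c = "hcoeff f (hdeg f)"
  let ?u = "hmonom (1 / ?c) (- hdeg f)"
  have c: "?c \<noteq> 0" by (rule hdeg(1)[OF assms])
  have "a > 0" if "hcoeff (1 - ?u * f) a \<noteq> 0" for a
  proof (cases "a = 0")
    case True
    then show ?thesis using that c by (simp add: hcoeff_1 hcoeff_hmonom_times)
  next
    case False
    then have "hcoeff f (a + hdeg f) \<noteq> 0" using that by (auto simp: hcoeff_1 hcoeff_hmonom_times)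
    then show ?thesis using hdeg(2)[OF assms] False by force
  qed
  then obtain h where "(1 - (1 - ?u * f)) * h = 1" using hahn_geometric_inverse by blast
  then have "f * (?u * h) = 1" by (simp add: algebra_simps)
  then show ?thesis by blast
qed

instantiation hahn :: field
begin

definition inverse_hahn :: "hahn \<Rightarrow> hahn"
  where "inverse f = (if f = 0 then 0 else THE g. f * g = 1)" for f :: hahn

definition divide_hahn :: "hahn \<Rightarrow> hahn \<Rightarrow> hahn"
  where "f div g = f * inverse g" for f g :: hahn

instance
proof
  fix f g :: hahn
  show "inverse f * f = 1" if f: "f \<noteq> 0"
  proof -
    obtain g where g: "f * g = 1" using hahn_inverse_exists[OF f] by blast
    have "g' = g" if "f * g' = 1" for g'
    proof -
      have "g' = (f * g) * g'" by (simp only: g mult_1)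
      also have "\<dots> = (f * g') * g" by (simp only: ac_simps)
      also have "\<dots> = g" by (simp only: that mult_1)
      finally show ?thesis .
    qed
    then have "(THE g. f * g = 1) = g" using g by (blast intro: the_equality)
    then have "f * inverse f = 1" using g f by (simp add: inverse_hahn_def)
    then show ?thesis by (simp only: mult.commute)
  qed
  show "f div g = f * inverse g" by (rule divide_hahn_def)
  show "inverse (0 :: hahn) = 0" by (simp add: inverse_hahn_def)
qed

end

section \<open>Tropical rank\<close>

text \<open>An \<open>r \<times> r\<close> matrix is a function on indices \<open>i, j < r\<close>.\<close>

definition tropical_weight :: "nat \<Rightarrow> (nat \<Rightarrow> nat \<Rightarrow> real) \<Rightarrow> (nat \<Rightarrow> nat) \<Rightarrow> real"
  where "tropical_weight r m \<sigma> = (\<Sum>i<r. m i (\<sigma> i))"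

definition tropically_singular :: "nat \<Rightarrow> (nat \<Rightarrow> nat \<Rightarrow> real) \<Rightarrow> bool"
  where "tropically_singular r m \<longleftrightarrow>
    2 \<le> card {\<sigma>. \<sigma> permutes {..<r} \<and>
      tropical_weight r m \<sigma> = Min (tropical_weight r m ` {\<tau>. \<tau> permutes {..<r}})}"

text \<open>Since \<open>'d\<close> and \<open>'n\<close> carry no order, the rows \<open>p 0, \<dots>, p (r - 1)\<close> and the columns
  \<open>q 0, \<dots>, q (r - 1)\<close> of a submatrix are listed in arbitrary order; tropical singularity does not
  depend on this order.  The empty submatrix (\<open>r = 0\<close>) is non-singular, which does not
  affect the maximum, as every \<open>1 \<times> 1\<close> matrix is non-singular.\<close>

definition has_tropically_nonsingular_submatrix :: "real^'n^'d \<Rightarrow> nat \<Rightarrow> bool"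
  where "has_tropically_nonsingular_submatrix M r \<longleftrightarrow>
    (\<exists>(p :: nat \<Rightarrow> 'd) (q :: nat \<Rightarrow> 'n). inj_on p {..<r} \<and> inj_on q {..<r} \<and>
      \<not> tropically_singular r (\<lambda>i j. M $ p i $ q j))"

definition tropical_rank :: "real^'n^'d \<Rightarrow> nat"
  where "tropical_rank M = Max {r. has_tropically_nonsingular_submatrix M r}"

section \<open>Kapranov rank\<close>

definition tropicalization :: "(hahn^'d) set \<Rightarrow> (real^'d) set"
  where "tropicalization V = {(\<chi> i. hdeg (f $ i)) |f. f \<in> V \<and> (\<forall>i. f $ i \<noteq> 0)}"

definition tropical_linear_space_of_dim :: "(real^'d) set \<Rightarrow> nat \<Rightarrow> bool"
  where "tropical_linear_space_of_dim L k \<longleftrightarrow>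
    (\<exists>V :: (hahn^'d) set. vec.subspace V \<and> vec.dim V = k \<and> L = tropicalization V)"

definition kapranov_rank :: "real^'n^'d \<Rightarrow> nat"
  where "kapranov_rank M = (LEAST k. \<exists>L. tropical_linear_space_of_dim L k \<and> columns M \<subseteq> L)"

end

theory Submission
  imports Defs
begin

text \<open>
  Kapranov rank \<open>d\<close> (the number of rows) means that no proper subspace of \<open>K\<^sup>d\<close>, where \<open>K\<close> is the
  field of generalized power series, tropicalizes to a set containing all columns of \<open>M\<close>.
  The proof compares this with the following alternative for real row shifts \<open>a\<close>:

  \<^item> if in every column \<open>j\<close> the minimum of \<open>a\<^sub>i + M\<^sub>i\<^sub>j\<close> over \<open>i\<close> is attained at least twice, then all
    columns lie in the tropicalization of the hyperplane \<open>\<Sum>\<^sub>i t\<^bsup>a\<^sub>i\<^esup> x\<^sub>i = 0\<close>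
    (\<open>tropical_hyperplane_lift\<close>), so the Kapranov rank is less than \<open>d\<close>;
  \<^item> if every row \<open>i\<close> is the unique minimizer of \<open>a\<^sub>i + M\<^sub>i\<^sub>j\<close> in some column \<open>j = Q i\<close>, then the columns
    \<open>Q i\<close> form a tropically non-singular \<open>d \<times> d\<close> submatrix, because the shifts change the weight of
    all permutations by the same amount and afterwards every column has its strict minimum on the
    diagonal (\<open>nonsingular_of_strict_column_minima\<close>).

  One of the two always happens for a suitable \<open>a\<close> (\<open>row_shift_alternative\<close>).  To see this, measure
  by a continuous function \<open>sector_measure M i a \<ge> 0\<close> whether row \<open>i\<close> is a unique minimizer
  somewhere.  Raising \<open>a\<^sub>i\<close> far above another shift makes the \<open>i\<close>-th value vanish, and Brouwer's
  fixed point theorem on a large box then gives shifts \<open>a\<close> for which these \<open>d\<close> numbers are all equal.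
  If they are all zero, the first case holds; if they are all positive, the second does.
\<close>

section \<open>Balancing the rows by Brouwer's theorem\<close>

text \<open>The product is used instead of the gap between the two smallest entries because its continuity
  is immediate; it is positive exactly when \<open>i\<close> is the only minimizer in column \<open>j\<close>, also for a
  single row, where it is the empty product \<open>1\<close>.\<close>

definition sector_measure :: "real^'n^'d \<Rightarrow> 'd \<Rightarrow> real^'d \<Rightarrow> real"
  where "sector_measure M i a =
    (\<Sum>j\<in>UNIV. \<Prod>k\<in>UNIV - {i}. max 0 (a $ k + M $ k $ j - (a $ i + M $ i $ j)))"

lemma continuous_sector_measure: "continuous_on S (sector_measure M i)"
  unfolding sector_measure_def by (intro continuous_intros)

lemma sector_measure_nonneg: "sector_measure M i a \<ge> 0"
  unfolding sector_measure_def by (intro sum_nonneg prod_nonneg) auto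

lemma sector_measure_pos_iff:
  "sector_measure M i a > 0 \<longleftrightarrow> (\<exists>j. \<forall>k. k \<noteq> i \<longrightarrow> a $ i + M $ i $ j < a $ k + M $ k $ j)"
proof -
  have max_eq_0: "max 0 (x - y) = 0 \<longleftrightarrow> x \<le> y" for x y :: real
    by linarith
  have "sector_measure M i a = 0 \<longleftrightarrow>
      (\<forall>j. \<exists>k. k \<noteq> i \<and> a $ k + M $ k $ j \<le> a $ i + M $ i $ j)"
    unfolding sector_measure_def
    by (subst sum_nonneg_eq_0_iff) (auto intro!: prod_nonneg simp: Bex_def max_eq_0)
  then show ?thesis
    using sector_measure_nonneg[of M i a] by (metis not_le order_le_less)
qed

text \<open>Once \<open>a\<^sub>i\<close> exceeds \<open>a\<^sub>k\<close> by the largest difference between two entries of one column, row \<open>k\<close>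
  undercuts or ties with row \<open>i\<close> everywhere.  This confines the search for balanced shifts to a box.\<close>

lemma sector_measure_eq_0_if_large_shift:
  assumes "\<And>i k j. M $ k $ j - M $ i $ j \<le> R" and "a $ i \<ge> a $ k + R" and "k \<noteq> i"
  shows "sector_measure M i a = 0"
proof -
  have "a $ k + M $ k $ j \<le> a $ i + M $ i $ j" for j
    using assms(1)[of k j i] assms(2) by linarith
  then have "\<not> sector_measure M i a > 0"
    unfolding sector_measure_pos_iff using assms(3) by (meson not_le)
  then show ?thesis using sector_measure_nonneg[of M i a] by linarith
qed

text \<open>Fix one row \<open>z\<close> with shift \<open>0\<close>, move every other shift by the difference of its value and that
  of \<open>z\<close>, and cut off at \<open>\<plusminus>R\<close>.  At a fixed point, a row with \<open>-R < a\<^sub>i < R\<close> has the same value as \<open>z\<close>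
  because it does not move.  At the upper end \<open>a\<^sub>i = R\<close> the value of \<open>i\<close> vanishes, at the lower end
  that of \<open>z\<close> does, and since \<open>i\<close> is not moved back into the box, the other value vanishes too.\<close>

lemma balanced_row_shifts:
  fixes M :: "real^'n^'d"
  obtains a where "\<And>i k. sector_measure M i a = sector_measure M k a"
proof -
  define R where "R = Max (range (\<lambda>(i, k, j). \<bar>M $ k $ j - M $ i $ j\<bar>))"
  have R: "\<bar>M $ k $ j - M $ i $ j\<bar> \<le> R" for i k j
    unfolding R_def by (rule Max_ge) (auto intro: range_eqI[of _ _ "(i, k, j)"])
  have R_bound: "M $ k $ j - M $ i $ j \<le> R" for i k j
    using R[of k j i] by linarith
  have R0: "R \<ge> 0" using R[of undefined undefined undefined] by linarith
  fix z :: 'd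
  define l u :: "real^'d" where "l = (\<chi> i. if i = z then 0 else - R)"
    and "u = (\<chi> i. if i = z then 0 else R)"
  define push where "push a = (\<chi> i. max (l $ i) (min (u $ i)
      (a $ i + (sector_measure M i a - sector_measure M z a))))" for a
  have lu: "l $ i \<le> u $ i" for i using R0 by (simp add: l_def u_def)
  have "continuous_on (cbox l u) push"
    unfolding push_def by (intro continuous_intros continuous_sector_measure)
  moreover have "push \<in> cbox l u \<rightarrow> cbox l u"
    using lu by (auto simp: push_def mem_box_cart)
  moreover have "cbox l u \<noteq> {}"
    using lu by (simp add: interval_ne_empty_cart)
  ultimately obtain a where a: "a \<in> cbox l u" "push a = a"
    using brouwer[of "cbox l u" push] compact_cbox convex_box(1) by metis
  have az: "a $ z = 0" using a(1) by (auto simp: mem_box_cart l_def u_def dest: spec[of _ z])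
  have "sector_measure M i a = sector_measure M z a" if i: "i \<noteq> z" for i
  proof -
    have fixed: "max (- R) (min R (a $ i + (sector_measure M i a - sector_measure M z a))) = a $ i"
      using arg_cong[OF a(2), of "\<lambda>v. v $ i"] i by (simp add: push_def l_def u_def)
    show ?thesis
    proof (cases "sector_measure M i a \<ge> sector_measure M z a")
      case True
      show ?thesis
      proof (cases "a $ i \<ge> R")
        case True
        then have "sector_measure M i a = 0"
          using i az by (intro sector_measure_eq_0_if_large_shift[of M R a z i] R_bound) auto
        then show ?thesis using \<open>sector_measure M i a \<ge> _\<close> sector_measure_nonneg[of M z a] by linarith
      qed (use True fixed R0 in linarith)
    next
      case False
      show ?thesis
      proof (cases "a $ i \<le> - R")
        case True
        then have "sector_measure M z a = 0"
          using i az by (intro sector_measure_eq_0_if_large_shift[of M R a i z] R_bound) auto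
        then show ?thesis using False sector_measure_nonneg[of M i a] by linarith
      qed (use False fixed R0 in linarith)
    qed
  qed
  then show ?thesis using that by metis
qed

lemma row_shift_alternative:
  fixes M :: "real^'n^'d"
  obtains
    (strict) a :: "real^'d" where
      "\<And>i. \<exists>j. \<forall>k. k \<noteq> i \<longrightarrow> a $ i + M $ i $ j < a $ k + M $ k $ j"
  | (tied) a :: "real^'d" where
      "\<And>i j. \<exists>k. k \<noteq> i \<and> a $ k + M $ k $ j \<le> a $ i + M $ i $ j"
proof -
  obtain a where a: "\<And>i k. sector_measure M i a = sector_measure M k a"
    using balanced_row_shifts[of M] by blast
  show ?thesis
  proof (cases "\<forall>i. sector_measure M i a > 0")
    case True
    then show ?thesis using strict[of a] by (simp add: sector_measure_pos_iff)
  next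
    case False
    then have "\<not> sector_measure M i a > 0" for i using a by metis
    then show ?thesis using tied[of a] unfolding sector_measure_pos_iff by (meson not_le)
  qed
qed

section \<open>Strict column minima give a non-singular submatrix\<close>

text \<open>Adding \<open>a\<^sub>i\<close> to row \<open>i\<close> adds \<open>\<Sum>\<^sub>i a\<^sub>i\<close> to the weight of every permutation, so the weights may be
  compared after the shift.  Listing the columns in the order of the rows whose strict minima they
  contain puts these minima on the diagonal, and every other permutation picks a larger entry in
  some column.\<close>

lemma nonsingular_of_strict_column_minima:
  fixes M :: "real^'n^'d"
  assumes strict: "\<And>i k. k \<noteq> i \<Longrightarrow> a $ i + M $ i $ Q i < a $ k + M $ k $ Q i"
  shows "has_tropically_nonsingular_submatrix M CARD('d)"
proof -
  obtain p :: "nat \<Rightarrow> 'd" where p: "bij_betw p {..<CARD('d)} UNIV"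
    using ex_bij_betw_nat_finite[OF finite[of UNIV]] by (auto simp: atLeast0LessThan)
  let ?r = "CARD('d)" and ?m = "\<lambda>i j. M $ p i $ Q (p j)"
  have inj_p: "inj_on p {..<?r}" using p by (rule bij_betw_imp_inj_on)
  have inj_Q: "inj Q"
    by (rule injI, rule ccontr) (metis strict less_asym)
  have id_least: "tropical_weight ?r ?m id < tropical_weight ?r ?m \<sigma>"
    if \<sigma>: "\<sigma> permutes {..<?r}" "\<sigma> \<noteq> id" for \<sigma>
  proof -
    let ?b = "\<lambda>i j. a $ p i + ?m i j"
    obtain i where i: "\<sigma> i \<noteq> i" using \<sigma>(2) by (auto simp: fun_eq_iff)
    have ir: "i < ?r" using i \<sigma>(1) by (metis lessThan_iff permutes_not_in)
    have strict_off: "?b (\<sigma> k) (\<sigma> k) < ?b k (\<sigma> k)" if "k < ?r" "\<sigma> k \<noteq> k" for k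
    proof -
      have "\<sigma> k < ?r" using that(1) \<sigma>(1) by (metis lessThan_iff permutes_in_image)
      then have "p k \<noteq> p (\<sigma> k)" using that inj_p by (metis inj_onD lessThan_iff)
      then show ?thesis by (rule strict)
    qed
    have "(\<Sum>k<?r. ?b k k) = (\<Sum>k<?r. ?b (\<sigma> k) (\<sigma> k))"
      by (rule sum.permute[OF \<sigma>(1), of "\<lambda>k. ?b k k", unfolded o_def])
    also have "\<dots> < (\<Sum>k<?r. ?b k (\<sigma> k))"
    proof (rule sum_strict_mono_ex1)
      show "\<forall>k\<in>{..<?r}. ?b (\<sigma> k) (\<sigma> k) \<le> ?b k (\<sigma> k)"
        using strict_off by (metis lessThan_iff less_imp_le order_refl)
      show "\<exists>k\<in>{..<?r}. ?b (\<sigma> k) (\<sigma> k) < ?b k (\<sigma> k)"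
        using strict_off[OF ir i] ir by blast
    qed simp
    finally show ?thesis by (simp add: tropical_weight_def sum.distrib)
  qed
  let ?P = "{\<sigma>. \<sigma> permutes {..<?r}}"
  have "{\<sigma>. \<sigma> permutes {..<?r} \<and> tropical_weight ?r ?m \<sigma> = Min (tropical_weight ?r ?m ` ?P)} \<subseteq> {id}"
  proof safe
    fix \<sigma> assume \<sigma>: "\<sigma> permutes {..<?r}"
      and min: "tropical_weight ?r ?m \<sigma> = Min (tropical_weight ?r ?m ` ?P)"
    have "Min (tropical_weight ?r ?m ` ?P) \<le> tropical_weight ?r ?m id"
      by (rule Min_le) (auto simp: finite_permutations permutes_id)
    then show "\<sigma> = id" using id_least[OF \<sigma>] min by fastforce
  qed
  then have "card {\<sigma>. \<sigma> permutes {..<?r} \<and>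
      tropical_weight ?r ?m \<sigma> = Min (tropical_weight ?r ?m ` ?P)} \<le> card {id :: nat \<Rightarrow> nat}"
    by (intro card_mono) auto
  then have "\<not> tropically_singular ?r ?m" unfolding tropically_singular_def by simp
  moreover have "inj_on (\<lambda>i. Q (p i)) {..<?r}"
    using inj_p inj_Q by (auto simp: inj_on_def)
  ultimately show ?thesis
    unfolding has_tropically_nonsingular_submatrix_def using inj_p by blast
qed

lemma has_tropically_nonsingular_submatrix_le:
  fixes M :: "real^'n^'d"
  assumes "has_tropically_nonsingular_submatrix M r"
  shows "r \<le> CARD('d)"
proof -
  obtain p :: "nat \<Rightarrow> 'd" where "inj_on p {..<r}"
    using assms unfolding has_tropically_nonsingular_submatrix_def by blast
  then have "card {..<r} \<le> CARD('d)" by (rule card_inj_on_le) auto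
  then show ?thesis by simp
qed

section \<open>Tied column minima give a hyperplane\<close>

lemma hmonom_mult: "hmonom c a * hmonom e b = hmonom (c * e) (a + b)"
  by (rule hahn_eqI) (auto simp: hcoeff_hmonom_times hcoeff_hmonom)

lemma hdeg_eqI:
  assumes "hcoeff f m \<noteq> 0" "\<And>a. hcoeff f a \<noteq> 0 \<Longrightarrow> m \<le> a"
  shows "hdeg f = m"
  unfolding hdeg_def by (rule Least_equality) (use assms in auto)

lemma hmonom_nonzero: "c \<noteq> 0 \<Longrightarrow> hmonom c a \<noteq> 0"
  using hcoeff_hmonom[of c a a] by fastforce

lemma hdeg_hmonom: "c \<noteq> 0 \<Longrightarrow> hdeg (hmonom c a) = a"
  by (rule hdeg_eqI) (auto simp: hcoeff_hmonom split: if_splits)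

definition monomial_hyperplane :: "real^'d \<Rightarrow> (hahn^'d) set"
  where "monomial_hyperplane a = {f. (\<Sum>i\<in>UNIV. hmonom 1 (a $ i) * f $ i) = 0}"

lemma subspace_monomial_hyperplane: "vec.subspace (monomial_hyperplane a)"
proof (rule vec.subspaceI)
  fix f and c :: hahn assume "f \<in> monomial_hyperplane a"
  moreover have "(\<Sum>i\<in>UNIV. hmonom 1 (a $ i) * (c *s f) $ i) =
      c * (\<Sum>i\<in>UNIV. hmonom 1 (a $ i) * f $ i)"
    by (simp add: sum_distrib_left mult.left_commute)
  ultimately show "c *s f \<in> monomial_hyperplane a" by (simp add: monomial_hyperplane_def)
qed (auto simp: monomial_hyperplane_def distrib_left sum.distrib)

lemma dim_monomial_hyperplane:
  fixes a :: "real^'d"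
  shows "vec.dim (monomial_hyperplane a) < CARD('d)"
proof (rule ccontr)
  assume "\<not> ?thesis"
  then have "vec.dim (UNIV :: (hahn^'d) set) \<le> vec.dim (monomial_hyperplane a)"
    by (metis not_le vec_dim_card)
  then have full: "monomial_hyperplane a = UNIV"
    by (intro vec.subspace_dim_equal subspace_monomial_hyperplane vec.subspace_UNIV) auto
  fix z :: 'd
  have "(\<Sum>i\<in>UNIV. hmonom 1 (a $ i) * axis z 1 $ i) = hmonom 1 (a $ z)"
    by (simp add: axis_def if_distrib[of "\<lambda>x. _ * x"] cong: if_cong)
  then have "axis z 1 \<notin> monomial_hyperplane a"
    by (simp add: monomial_hyperplane_def hmonom_nonzero)
  then show False using full by blast
qed

text \<open>If the minimum of \<open>a\<^sub>i + v\<^sub>i\<close> is attained at \<open>z\<close>, take the monomials \<open>t\<^bsup>v\<^sub>i\<^esup>\<close> in all coordinates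
  \<open>i \<noteq> z\<close> and solve the linear equation for the coordinate \<open>z\<close>.  The solution has degree
  \<open>v\<^sub>z\<close> since the minimum is also attained elsewhere: the lowest coefficient is minus the
  number of further minimizers, which is non-zero in characteristic \<open>0\<close>.\<close>

lemma tropical_hyperplane_lift:
  fixes a v :: "real^'d"
  assumes tied: "\<And>i. \<exists>k. k \<noteq> i \<and> a $ k + v $ k \<le> a $ i + v $ i"
  shows "v \<in> tropicalization (monomial_hyperplane a)"
proof -
  define b where "b i = a $ i + v $ i" for i
  obtain z where z: "\<And>i. b z \<le> b i"
    using ex_min_if_finite[of "range b"] by (metis (no_types, lifting) UNIV_not_empty arg_min_if_finite(2) finite not_le UNIV_I)
  obtain k where k: "k \<noteq> z" "b k = b z"
    using tied[of z] z by (metis b_def order_antisym)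
  define s where "s = (\<Sum>i\<in>UNIV - {z}. hmonom 1 (b i - a $ z))"
  define f where "f = (\<chi> i. if i = z then - s else hmonom 1 (v $ i))"
  have s: "hcoeff s c = of_nat (card {i \<in> UNIV - {z}. c = b i - a $ z})" for c
    unfolding s_def hcoeff_sum hcoeff_hmonom by (subst sum.If_cases) (auto simp: Int_def)
  have deg_coeff: "hcoeff s (v $ z) \<noteq> 0"
  proof -
    have "k \<in> {i \<in> UNIV - {z}. v $ z = b i - a $ z}" using k by (simp add: b_def[of z])
    then have "card {i \<in> UNIV - {z}. v $ z = b i - a $ z} \<noteq> 0"
      by (metis (no_types, lifting) card_0_eq empty_iff finite)
    then show ?thesis unfolding s by simp
  qed
  have "hdeg (- s) = v $ z"
  proof (rule hdeg_eqI)
    fix c assume "hcoeff (- s) c \<noteq> 0"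
    then have "{i \<in> UNIV - {z}. c = b i - a $ z} \<noteq> {}" unfolding hcoeff_uminus s by force
    then obtain i where "c = b i - a $ z" by blast
    then show "v $ z \<le> c" using z[of i] by (simp add: b_def[of z])
  qed (use deg_coeff in simp)
  moreover have "- s \<noteq> 0" using deg_coeff by auto
  ultimately have deg: "f $ i \<noteq> 0 \<and> hdeg (f $ i) = v $ i" for i
    by (simp add: f_def hdeg_hmonom hmonom_nonzero)
  have "(\<Sum>i\<in>UNIV. hmonom 1 (a $ i) * f $ i) =
      hmonom 1 (a $ z) * (- s) + (\<Sum>i\<in>UNIV - {z}. hmonom 1 (a $ i) * hmonom 1 (v $ i))"
    by (subst sum.remove[of _ z]) (auto simp: f_def)
  also have "\<dots> = 0"
    by (simp add: s_def sum_distrib_left hmonom_mult b_def)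
  finally have "f \<in> monomial_hyperplane a" by (simp add: monomial_hyperplane_def)
  moreover have "v = (\<chi> i. hdeg (f $ i))" using deg by (simp add: vec_eq_iff)
  ultimately show ?thesis unfolding tropicalization_def using deg by blast
qed

lemma kapranov_rank_less_if_tied:
  fixes M :: "real^'n^'d"
  assumes "\<And>i j. \<exists>k. k \<noteq> i \<and> a $ k + M $ k $ j \<le> a $ i + M $ i $ j"
  shows "kapranov_rank M < CARD('d)"
proof -
  let ?V = "monomial_hyperplane a"
  have "column j M \<in> tropicalization ?V" for j
    using assms by (intro tropical_hyperplane_lift) (simp add: column_def)
  then have "columns M \<subseteq> tropicalization ?V" by (auto simp: columns_def)
  moreover have "tropical_linear_space_of_dim (tropicalization ?V) (vec.dim ?V)"
    unfolding tropical_linear_space_of_dim_def using subspace_monomial_hyperplane by blast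
  ultimately have "kapranov_rank M \<le> vec.dim ?V"
    unfolding kapranov_rank_def by (intro Least_le) blast
  then show ?thesis using dim_monomial_hyperplane[of a] by linarith
qed

section \<open>Full Kapranov rank implies full tropical rank\<close>

theorem theorem5p5:
  fixes M :: "real^'n^'d"
  assumes "kapranov_rank M = CARD('d)"
  shows "tropical_rank M = CARD('d)"
proof (cases rule: row_shift_alternative[of M])
  case (strict a)
  then obtain Q where "\<And>i k. k \<noteq> i \<Longrightarrow> a $ i + M $ i $ Q i < a $ k + M $ k $ Q i"
    by metis
  then have "has_tropically_nonsingular_submatrix M CARD('d)"
    by (rule nonsingular_of_strict_column_minima)
  moreover have "finite {r. has_tropically_nonsingular_submatrix M r}"
    by (rule finite_subset[of _ "{..CARD('d)}"]) (auto dest: has_tropically_nonsingular_submatrix_le)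
  ultimately show ?thesis
    unfolding tropical_rank_def by (intro Max_eqI) (auto dest: has_tropically_nonsingular_submatrix_le)
next
  case (tied a)
  then show ?thesis using kapranov_rank_less_if_tied[of a M] assms by simp
qed

end
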